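(* Let $p$ be a propositional variable. There is no formula $\varphi\in\mathsf L_{\mathsf R}$ such that $\Diamond p\leftrightarrow\varphi$ is valid over the class of persistent models.
   Context: $\mathsf L_{\mathsf R}$: formulas built from variables and $\bot$ using $\wedge,\vee,\to,\bigcirc,\mathsf R$. A persistent model is $(W,\preccurlyeq,S,V)$ with $\preccurlyeq$ a partial order on nonempty $W$, $S\colon W\to W$ forward confluent ($w\preccurlyeq v\Rightarrow S(w)\preccurlyeq S(v)$) and backward confluent (if $v\succcurlyeq S(w)$ then there is $u\succcurlyeq w$ with $S(u)=v$), and monotone $V\colon W\to\mathcal P(\mathbb P)$. Satisfaction: atoms by $V$; $\bot$ false; $\wedge,\vee$ classical; $w\models\bigcirc\varphi$ iff $S(w)\models\varphi$; $w\models\varphi\to\psi$ iff every $v\succcurlyeq w$ with $v\models\varphi$ has $v\models\psi$; $w\models\Diamond\varphi$ iff $S^k(w)\models\varphi$ for some $k\ge0$; $w\models\varphi\,\mathsf R\,\psi$ iff for all $k\ge0$, $S^k(w)\models\psi$ or $S^i(w)\models\varphi$ for some $i\in[0,k)$. *)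

theory Defs
  imports Main
begin

datatype 'p fm =
    Var 'p
  | Bot
  | And "'p fm" "'p fm"
  | Or "'p fm" "'p fm"
  | Imp "'p fm" "'p fm"
  | Next "'p fm"
  | Dia "'p fm"
  | Release "'p fm" "'p fm"

definition Iff :: "'p fm \<Rightarrow> 'p fm \<Rightarrow> 'p fm" where
  "Iff \<phi> \<psi> = And (Imp \<phi> \<psi>) (Imp \<psi> \<phi>)"

inductive_set L_R :: "'p fm set" where
  Var: "Var x \<in> L_R"
| Bot: "Bot \<in> L_R"
| And: "\<phi> \<in> L_R \<Longrightarrow> \<psi> \<in> L_R \<Longrightarrow> And \<phi> \<psi> \<in> L_R"
| Or: "\<phi> \<in> L_R \<Longrightarrow> \<psi> \<in> L_R \<Longrightarrow> Or \<phi> \<psi> \<in> L_R"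
| Imp: "\<phi> \<in> L_R \<Longrightarrow> \<psi> \<in> L_R \<Longrightarrow> Imp \<phi> \<psi> \<in> L_R"
| Next: "\<phi> \<in> L_R \<Longrightarrow> Next \<phi> \<in> L_R"
| Release: "\<phi> \<in> L_R \<Longrightarrow> \<psi> \<in> L_R \<Longrightarrow> Release \<phi> \<psi> \<in> L_R"

text \<open>Models are carried by a set \<open>W\<close> of worlds; \<open>(w, v) \<in> le\<close> means that \<open>w\<close> is below \<open>v\<close>.
  Outside \<open>W\<close> the values of \<open>S\<close> and \<open>V\<close> are irrelevant.\<close>

locale persistent_model =
  fixes W :: "'w set"
    and le :: "('w \<times> 'w) set"
    and S :: "'w \<Rightarrow> 'w"
    and V :: "'w \<Rightarrow> 'p set"
  assumes nonempty: "W \<noteq> {}"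
    and le_partial_order: "partial_order_on W le"
    and S_closed: "w \<in> W \<Longrightarrow> S w \<in> W"
    and forward_confluent: "(w, v) \<in> le \<Longrightarrow> (S w, S v) \<in> le"
    and backward_confluent: "w \<in> W \<Longrightarrow> (S w, v) \<in> le \<Longrightarrow> \<exists>u. (w, u) \<in> le \<and> S u = v"
    and V_mono: "(w, v) \<in> le \<Longrightarrow> V w \<subseteq> V v"

primrec sat ::
  "('w \<times> 'w) set \<Rightarrow> ('w \<Rightarrow> 'w) \<Rightarrow> ('w \<Rightarrow> 'p set) \<Rightarrow> 'w \<Rightarrow> 'p fm \<Rightarrow> bool" where
  "sat le S V w (Var x) \<longleftrightarrow> x \<in> V w"
| "sat le S V w Bot \<longleftrightarrow> False"
| "sat le S V w (And \<phi> \<psi>) \<longleftrightarrow> sat le S V w \<phi> \<and> sat le S V w \<psi>"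
| "sat le S V w (Or \<phi> \<psi>) \<longleftrightarrow> sat le S V w \<phi> \<or> sat le S V w \<psi>"
| "sat le S V w (Imp \<phi> \<psi>) \<longleftrightarrow> (\<forall>v. (w, v) \<in> le \<longrightarrow> sat le S V v \<phi> \<longrightarrow> sat le S V v \<psi>)"
| "sat le S V w (Next \<phi>) \<longleftrightarrow> sat le S V (S w) \<phi>"
| "sat le S V w (Dia \<phi>) \<longleftrightarrow> (\<exists>k. sat le S V ((S ^^ k) w) \<phi>)"
| "sat le S V w (Release \<phi> \<psi>) \<longleftrightarrow>
     (\<forall>k. sat le S V ((S ^^ k) w) \<psi> \<or> (\<exists>i<k. sat le S V ((S ^^ i) w) \<phi>))"

text \<open>Validity over all persistent models whose worlds are drawn from the type \<open>'w\<close>. HOL cannot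
  quantify over types inside a formula, so the universe of worlds is a parameter. Every infinite
  type yields the same notion as the class of all persistent models: closing a countermodel under
  \<open>S\<close>, witnesses for failing implications and witnesses for backward confluence gives a countable
  one, which is isomorphic to a model carried by a subset of \<open>'w\<close>.\<close>

definition valid_persistent :: "'w itself \<Rightarrow> 'p fm \<Rightarrow> bool" where
  "valid_persistent (_ :: 'w itself) \<phi> \<longleftrightarrow>
     (\<forall>(W :: 'w set) le S V. persistent_model W le S V \<longrightarrow> (\<forall>w\<in>W. sat le S V w \<phi>))"

end

theory Submission
  imports Defs Complex_Main
begin

text \<open>
  Take all finite sets of natural numbers, ordered by inclusion, with the downward shift as
  successor and \<open>p\<close> true at \<open>A\<close> iff \<open>0 \<in> A\<close>; this is a countable persistent model. Refuting an
  \<open>L_R\<close> formula at \<open>A\<close> inspects only finitely many instants, up to moving to a larger set, so the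
  refutation survives adding any sufficiently large \<open>N\<close> to \<open>A\<close>. But \<open>\<diamond>p\<close> is false at the empty
  set and true at every \<open>{N}\<close>.
\<close>

lemma (in persistent_model) funpow_le:
  assumes "(w, v) \<in> le"
  shows "((S ^^ k) w, (S ^^ k) v) \<in> le"
  using assms by (induction k) (auto intro: forward_confluent)

text \<open>Forward confluence carries the order along \<open>S\<close>-orbits, so temporal
  operators inherit monotonicity; implication needs only transitivity. This keeps antecedents true
  when a set is enlarged.\<close>

lemma (in persistent_model) sat_mono:
  assumes "sat le S V w \<phi>" and "(w, v) \<in> le"
  shows "sat le S V v \<phi>"
  using assms
proof (induction \<phi> arbitrary: w v)
  case (Var x)
  then show ?case using V_mono by auto
next
  case (Imp \<phi> \<psi>)
  have "trans le"
    using le_partial_order by (simp add: partial_order_on_def preorder_on_def)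
  with Imp.prems show ?case by (auto dest: transD)
next
  case (Next \<phi>)
  then show ?case using forward_confluent by auto
next
  case (Dia \<phi>)
  then show ?case using funpow_le by fastforce
next
  case (Release \<phi> \<psi>)
  show ?case
    unfolding sat.simps
  proof
    fix k
    have "sat le S V ((S ^^ k) w) \<psi> \<or> (\<exists>i<k. sat le S V ((S ^^ i) w) \<phi>)"
      using Release.prems by simp
    then show "sat le S V ((S ^^ k) v) \<psi> \<or> (\<exists>i<k. sat le S V ((S ^^ i) v) \<phi>)"
      using Release.IH funpow_le[OF Release.prems(2)] by blast
  qed
qed auto

context
  fixes f :: "'a \<Rightarrow> 'b"
  assumes inj: "inj f"
begin

text \<open>The bit model lives on \<open>nat\<close>, whereas validity ranges over models inside
  \<open>'w\<close>. Since \<open>inv f\<close> undoes \<open>f\<close>, the conjugated successor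
  follows the old orbits, and every world above \<open>f w\<close> is again an image.\<close>

lemma sat_image:
  "sat (map_prod f f ` le) (f \<circ> S \<circ> inv f) (V \<circ> inv f) (f w) \<phi> \<longleftrightarrow> sat le S V w \<phi>"
proof (induction \<phi> arbitrary: w)
  case (Imp \<phi> \<psi>)
  have "(f w, v) \<in> map_prod f f ` le \<longleftrightarrow> (\<exists>u. v = f u \<and> (w, u) \<in> le)" for v
    using inj by (auto simp: inj_eq)
  then show ?case using Imp by auto
next
  case (Dia \<phi>)
  have "((f \<circ> S \<circ> inv f) ^^ k) (f w) = f ((S ^^ k) w)" for k
    by (induction k) (simp_all add: inj)
  then show ?case using Dia by (simp del: comp_apply)
next
  case (Release \<phi> \<psi>)
  have "((f \<circ> S \<circ> inv f) ^^ k) (f w) = f ((S ^^ k) w)" for k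
    by (induction k) (simp_all add: inj)
  then show ?case using Release by (simp del: comp_apply)
qed (simp_all add: inj)

lemma persistent_model_image:
  assumes "persistent_model UNIV le S V"
  shows "persistent_model (range f) (map_prod f f ` le) (f \<circ> S \<circ> inv f) (V \<circ> inv f)"
proof -
  interpret persistent_model UNIV le S V by fact
  have "refl le" "trans le" "antisym le"
    using le_partial_order by (simp_all add: partial_order_on_def preorder_on_def)
  then have "refl_on (range f) (map_prod f f ` le)" "trans (map_prod f f ` le)"
      "antisym (map_prod f f ` le)"
    using inj
    by (auto simp: refl_on_def inj_eq intro!: transI antisymI dest: transD antisymD)
  moreover have "map_prod f f ` le \<subseteq> range f \<times> range f" by auto
  ultimately have po: "partial_order_on (range f) (map_prod f f ` le)"
    by (simp add: partial_order_on_def preorder_on_def)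
  show ?thesis
  proof
    show "partial_order_on (range f) (map_prod f f ` le)" by (fact po)
  next
    fix w v assume "w \<in> range f" "((f \<circ> S \<circ> inv f) w, v) \<in> map_prod f f ` le"
    then obtain a b where ab: "w = f a" "v = f b" "(S a, b) \<in> le"
      using inj by (auto simp: inj_eq)
    then obtain u where "(a, u) \<in> le" "S u = b"
      using backward_confluent by auto
    with ab show "\<exists>u. (w, u) \<in> map_prod f f ` le \<and> (f \<circ> S \<circ> inv f) u = v"
      by (intro exI[of _ "f u"]) (auto simp: inj)
  qed (use inj in \<open>auto dest: V_mono[THEN subsetD] intro!: map_prod_imageI forward_confluent\<close>)
qed

end

text \<open>A finite set of naturals is coded by the number having it as its set of binary digits.\<close>

definition bit_le :: "(nat \<times> nat) set" where
  "bit_le = {(m, n). \<forall>i. bit m i \<longrightarrow> bit n i}"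

definition half :: "nat \<Rightarrow> nat" where
  "half n = n div 2"

text \<open>All variables share one truth value, so a single model serves every
  \<open>p\<close>.\<close>

definition bit_val :: "nat \<Rightarrow> 'p set" where
  "bit_val n = (if odd n then UNIV else {})"

lemma bit_half [simp]: "bit (half n) i \<longleftrightarrow> bit n (Suc i)"
  by (simp add: half_def bit_Suc)

lemma half_set_bit_Suc: "half (set_bit (Suc N) m) = set_bit N (half m)"
  by (rule bit_eqI) (simp add: bit_set_bit_iff)

lemma bit_funpow_half: "bit ((half ^^ k) n) i \<longleftrightarrow> bit n (i + k)"
  by (induction k arbitrary: i) simp_all

lemma funpow_half_set_bit: "(half ^^ k) (set_bit (N + k) m) = set_bit N ((half ^^ k) m)"
  by (rule bit_eqI) (simp add: bit_funpow_half bit_set_bit_iff)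

lemma bit_le_set_bit: "(m, set_bit N m) \<in> bit_le"
  by (simp add: bit_le_def bit_set_bit_iff)

lemma persistent_model_bits: "persistent_model UNIV bit_le half bit_val"
proof
  have "refl bit_le" "trans bit_le" "antisym bit_le"
    by (auto simp: bit_le_def refl_on_def intro!: transI antisymI bit_eqI)
  then show "partial_order_on UNIV bit_le"
    by (simp add: partial_order_on_def preorder_on_def)
next
  fix w v assume wv: "(half w, v) \<in> bit_le"
  \<comment> \<open>The witness shifts the digits of \<open>v\<close> up by one and keeps the lowest
    digit of \<open>w\<close>, which \<open>half\<close> discards.\<close>
  have "bit (2 * v + w mod 2) i" if "bit w i" for i
  proof (cases i)
    case 0
    with that show ?thesis by (simp add: bit_0)
  next
    case (Suc j)
    with that wv show ?thesis by (simp add: bit_Suc bit_le_def)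
  qed
  then show "\<exists>u. (w, u) \<in> bit_le \<and> half u = v"
    by (intro exI[of _ "2 * v + w mod 2"]) (simp add: bit_le_def half_def)
next
  fix w v :: nat assume "(w, v) \<in> bit_le"
  then show "bit_val w \<subseteq> bit_val v"
    by (auto simp: bit_le_def bit_val_def simp flip: bit_0)
qed (auto simp: bit_le_def)

text \<open>Finitely many thresholds on \<open>N\<close> can be merged, which suffices for each
  constructor of \<open>L_R\<close>; a refuted \<open>Dia\<close> would instead impose one threshold
  per instant. The set \<open>m\<close> must vary, as implication enlarges it and the temporal
  operators shift it.\<close>

lemma refutation_survives_set_bit:
  assumes "\<phi> \<in> L_R" and "\<not> sat bit_le half bit_val m \<phi>"
  shows "\<forall>\<^sub>F N in sequentially. \<not> sat bit_le half bit_val (set_bit N m) \<phi>"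
  using assms
proof (induction arbitrary: m)
  case (Var x)
  \<comment> \<open>Variables depend on the digit 0 alone, so only adding \<open>0\<close> could
    make one true.\<close>
  have "\<not> sat bit_le half bit_val (set_bit N m) (Var x)" if "N \<ge> 1" for N
    using Var that by (simp add: bit_val_def bit_set_bit_iff flip: bit_0 split: if_splits)
  then show ?case by (rule eventually_sequentiallyI)
next
  case Bot
  then show ?case by simp
next
  case (And \<phi> \<psi>)
  then show ?case by (auto intro: eventually_mono[OF And.IH(1)] eventually_mono[OF And.IH(2)])
next
  case (Or \<phi> \<psi>)
  then show ?case by (simp add: eventually_conj)
next
  case (Imp \<phi> \<psi>)
  interpret persistent_model UNIV bit_le half bit_val by (rule persistent_model_bits)
  obtain n where n: "(m, n) \<in> bit_le" "sat bit_le half bit_val n \<phi>" "\<not> sat bit_le half bit_val n \<psi>"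
    using Imp.prems by auto
  \<comment> \<open>Adding the same \<open>N\<close> to \<open>m\<close> and to the countermodel
    world \<open>n\<close> preserves inclusion.\<close>
  have "(set_bit N m, set_bit N n) \<in> bit_le" for N
    using n(1) by (simp add: bit_le_def bit_set_bit_iff)
  moreover have "sat bit_le half bit_val (set_bit N n) \<phi>" for N
    using n(2) bit_le_set_bit by (rule sat_mono)
  ultimately show ?case
    using Imp.IH(2)[OF n(3)] by (auto elim!: eventually_mono)
next
  case (Next \<phi>)
  \<comment> \<open>Adding \<open>N\<close> after the shift is adding \<open>Suc N\<close> before
    it; eventual truth ignores the offset.\<close>
  then have "\<forall>\<^sub>F N in sequentially. \<not> sat bit_le half bit_val (half (set_bit (Suc N) m)) \<phi>"
    by (simp add: half_set_bit_Suc)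
  then show ?case
    using eventually_sequentially_Suc[of "\<lambda>N. \<not> sat bit_le half bit_val (half (set_bit N m)) \<phi>"]
    by simp
next
  case (Release \<phi> \<psi>)
  \<comment> \<open>The same index shift for \<open>i\<close> instants transfers the induction
    hypothesis to any fixed instant.\<close>
  have later: "\<forall>\<^sub>F N in sequentially. \<not> sat bit_le half bit_val ((half ^^ i) (set_bit N m)) \<chi>"
    if "\<And>m. \<not> sat bit_le half bit_val m \<chi> \<Longrightarrow>
          \<forall>\<^sub>F N in sequentially. \<not> sat bit_le half bit_val (set_bit N m) \<chi>"
      and "\<not> sat bit_le half bit_val ((half ^^ i) m) \<chi>" for i \<chi>
  proof -
    have "\<forall>\<^sub>F N in sequentially. \<not> sat bit_le half bit_val ((half ^^ i) (set_bit (N + i) m)) \<chi>"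
      using that by (simp add: funpow_half_set_bit)
    then show ?thesis by (rule eventually_sequentially_seg[THEN iffD1])
  qed
  \<comment> \<open>Only the instants \<open>0\<close> to \<open>k\<close> matter for this
    refutation.\<close>
  obtain k where k: "\<not> sat bit_le half bit_val ((half ^^ k) m) \<psi>"
      "\<And>i. i < k \<Longrightarrow> \<not> sat bit_le half bit_val ((half ^^ i) m) \<phi>"
    using Release.prems by auto
  have "\<forall>\<^sub>F N in sequentially. \<forall>i\<in>{..<k}.
      \<not> sat bit_le half bit_val ((half ^^ i) (set_bit N m)) \<phi>"
    using later[OF Release.IH(1)] k(2) by (intro eventually_ball_finite) auto
  moreover have "\<forall>\<^sub>F N in sequentially. \<not> sat bit_le half bit_val ((half ^^ k) (set_bit N m)) \<psi>"
    using later[OF Release.IH(2)] k(1) by simp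
  ultimately show ?case
    by eventually_elim auto
qed

theorem theorem8p13:
  fixes p :: 'p
  assumes "infinite (UNIV :: 'w set)"
  shows "\<not> (\<exists>\<phi> \<in> L_R. valid_persistent TYPE('w) (Iff (Dia (Var p)) \<phi>))"
proof
  assume "\<exists>\<phi> \<in> L_R. valid_persistent TYPE('w) (Iff (Dia (Var p)) \<phi>)"
  then obtain \<phi> where \<phi>: "\<phi> \<in> L_R" "valid_persistent TYPE('w) (Iff (Dia (Var p)) \<phi>)"
    by blast
  obtain f :: "nat \<Rightarrow> 'w" where "inj f"
    using assms infinite_countable_subset by blast
  have "sat bit_le half bit_val n (Iff (Dia (Var p)) \<phi>)" for n
    using \<phi>(2) persistent_model_image[OF \<open>inj f\<close> persistent_model_bits]
    unfolding valid_persistent_def sat_image[OF \<open>inj f\<close>, symmetric] by blast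
  moreover have "(n, n) \<in> bit_le" for n
    by (simp add: bit_le_def)
  ultimately have equiv:
    "sat bit_le half bit_val n (Dia (Var p)) \<longleftrightarrow> sat bit_le half bit_val n \<phi>" for n
    by (fastforce simp: Iff_def)
  \<comment> \<open>After \<open>k\<close> shifts, digit \<open>k\<close> is in the lowest position,
    so \<open>Dia (Var p)\<close> expresses nonemptiness.\<close>
  have Dia: "sat bit_le half bit_val n (Dia (Var p)) \<longleftrightarrow> (\<exists>k. bit n k)" for n
    by (simp add: bit_val_def bit_funpow_half flip: bit_0)
  have "\<not> sat bit_le half bit_val 0 \<phi>"
    using equiv Dia by (metis bit_0_eq bot_apply bot_bool_def)
  from refutation_survives_set_bit[OF \<phi>(1) this]
  obtain N where "\<not> sat bit_le half bit_val (set_bit N 0) \<phi>"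
    by (auto simp: eventually_sequentially)
  moreover have "bit (set_bit N 0 :: nat) N"
    by (simp add: bit_exp_iff)
  ultimately show False
    using equiv Dia by blast
qed

end
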